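(* Fix an integer $m\ge1$ and $\omega\in\mathbb Z\setminus\{0\}$. There exists $C_{m,\omega}>0$ such that every smooth closed immersed planar curve $\gamma$ with turning number $\omega[\gamma]=\omega$ satisfies $$\int_\gamma\mathcal K_m^2\,ds\ \ge\ C_{m,\omega}\,L[\gamma]^{-(2m+4)}E_m[\gamma].$$
   Context: $s$ arclength, $k$ signed curvature ($T=\partial_s\gamma$, $N=\mathsf RT$ with $\mathsf R(x,y)=(-y,x)$, $\partial_sT=kN$), $k_{s^j}$ the $j$-th arclength derivative of $k$, $L[\gamma]$ the length, $\omega[\gamma]=\frac1{2\pi}\int_\gamma k\,ds$ the turning number, $E_m[\gamma]=\frac12\int_\gamma k_{s^m}^2ds$, and $\mathcal K_m=(-1)^{m+1}k_{s^{2m+2}}-\tfrac12 k\,k_{s^m}^2+k\sum_{r=1}^m(-1)^{r+1}k_{s^{m-r}}k_{s^{m+r}}$. *)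

theory Defs
  imports "HOL-Analysis.Analysis"
begin

text \<open>A planar curve is a map gamma :: real => real * real; a closed curve is
  parametrised periodically with period 1 (its parameter domain is [0,1]).\<close>

definition cx :: "(real \<Rightarrow> real \<times> real) \<Rightarrow> real \<Rightarrow> real" where
  "cx \<gamma> = (\<lambda>t. fst (\<gamma> t))"

definition cy :: "(real \<Rightarrow> real \<times> real) \<Rightarrow> real \<Rightarrow> real" where
  "cy \<gamma> = (\<lambda>t. snd (\<gamma> t))"

definition smooth_fun :: "(real \<Rightarrow> real) \<Rightarrow> bool" where
  "smooth_fun f \<longleftrightarrow> (\<forall>n t. ((deriv ^^ n) f) differentiable (at t))"

definition smooth_closed_immersed :: "(real \<Rightarrow> real \<times> real) \<Rightarrow> bool" where
  "smooth_closed_immersed \<gamma> \<longleftrightarrow>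
     smooth_fun (cx \<gamma>) \<and> smooth_fun (cy \<gamma>) \<and>
     (\<forall>t. \<gamma> (t + 1) = \<gamma> t) \<and>
     (\<forall>t. (deriv (cx \<gamma>) t, deriv (cy \<gamma>) t) \<noteq> (0, 0))"

definition speed :: "(real \<Rightarrow> real \<times> real) \<Rightarrow> real \<Rightarrow> real" where
  "speed \<gamma> t = sqrt ((deriv (cx \<gamma>) t)\<^sup>2 + (deriv (cy \<gamma>) t)\<^sup>2)"

definition sderiv :: "(real \<Rightarrow> real \<times> real) \<Rightarrow> (real \<Rightarrow> real) \<Rightarrow> real \<Rightarrow> real" where
  "sderiv \<gamma> f = (\<lambda>t. deriv f t / speed \<gamma> t)"

text \<open>signed curvature: partial_s T = k N with N = R T, R(x,y) = (-y,x)\<close>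
definition curv :: "(real \<Rightarrow> real \<times> real) \<Rightarrow> real \<Rightarrow> real" where
  "curv \<gamma> = (\<lambda>t. (deriv (cx \<gamma>) t * deriv (deriv (cy \<gamma>)) t
                    - deriv (cy \<gamma>) t * deriv (deriv (cx \<gamma>)) t) / (speed \<gamma> t) ^ 3)"

definition curv_s :: "(real \<Rightarrow> real \<times> real) \<Rightarrow> nat \<Rightarrow> real \<Rightarrow> real" where
  "curv_s \<gamma> j = (sderiv \<gamma> ^^ j) (curv \<gamma>)"

definition curve_integral_ds :: "(real \<Rightarrow> real \<times> real) \<Rightarrow> (real \<Rightarrow> real) \<Rightarrow> real" where
  "curve_integral_ds \<gamma> f = integral {0..1} (\<lambda>t. f t * speed \<gamma> t)"

definition curve_length :: "(real \<Rightarrow> real \<times> real) \<Rightarrow> real" where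
  "curve_length \<gamma> = curve_integral_ds \<gamma> (\<lambda>t. 1)"

definition turning_number :: "(real \<Rightarrow> real \<times> real) \<Rightarrow> real" where
  "turning_number \<gamma> = curve_integral_ds \<gamma> (curv \<gamma>) / (2 * pi)"

definition energy :: "nat \<Rightarrow> (real \<Rightarrow> real \<times> real) \<Rightarrow> real" where
  "energy m \<gamma> = curve_integral_ds \<gamma> (\<lambda>t. (curv_s \<gamma> m t)\<^sup>2) / 2"

definition Kop :: "nat \<Rightarrow> (real \<Rightarrow> real \<times> real) \<Rightarrow> real \<Rightarrow> real" where
  "Kop m \<gamma> = (\<lambda>t. (-1) ^ (m + 1) * curv_s \<gamma> (2 * m + 2) t
      - curv \<gamma> t * (curv_s \<gamma> m t)\<^sup>2 / 2
      + curv \<gamma> t * (\<Sum>r = 1..m. (-1) ^ (r + 1) * curv_s \<gamma> (m - r) t * curv_s \<gamma> (m + r) t))"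

end

theory Submission
  imports Defs
begin

text \<open>
  Write \<open>F = \<Sum>r=1..m. (-1) ^ (r + 1) * k (m - r) * k (m + r) - (k m)\<^sup>2 / 2\<close> and
  \<open>G = (-1) ^ (m + 1) * k (2 * m + 1)\<close>. Then \<open>F' = k G\<close> and \<open>G' + k F = K\<close> (with \<open>K\<close> the gradient
  of the energy), so the vector field \<open>J = F T + G N\<close> satisfies \<open>J' = K N\<close>; hence \<open>J\<close> is constant
  up to \<open>\<integral> \<bar>K\<bar>\<close>.

  Normalise the length to 1. Integrating \<open>F = J \<bullet> T\<close> over the closed curve gives
  \<open>(m + 1/2) \<integral> (k m)\<^sup>2 \<le> 2 \<integral> \<bar>K\<bar>\<close>, which suffices unless \<open>\<epsilon>\<^sup>2 = \<integral> (k m)\<^sup>2\<close> is small.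
  If \<open>\<epsilon>\<close> is small, the curvature is close to its mean \<open>\<kappa> \<noteq> 0\<close>. With \<open>U = sup \<bar>k (2 * m)\<bar>\<close>, the
  function \<open>F\<close> equals \<open>\<plusminus> k * k (2 * m)\<close> up to \<open>O(\<epsilon> U)\<close>, and closedness of the curve makes all
  \<open>\<integral> k j T\<close> of size \<open>O(\<epsilon> U)\<close>. Testing \<open>F \<approx> J(0) \<bullet> T\<close> against \<open>T\<close> therefore
  bounds \<open>J(0)\<close>, whence \<open>U \<le> C (\<integral> \<bar>K\<bar> + \<epsilon> U)\<close>, and the last term is absorbed.
\<close>

section \<open>Weighted integrals over the unit interval\<close>

text \<open>\<open>v\<close> models the speed divided by the length: integrals against
  \<open>v\<close> are arclength averages computed in the given parameter, so no arclength
  reparametrisation has to be constructed.\<close>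

locale unit_weight =
  fixes v :: "real \<Rightarrow> real"
  assumes v_cont: "continuous_on {0..1} v"
    and v_pos: "\<And>t. v t > 0"
    and v_unit: "integral {0..1} v = 1"
begin

definition I :: "(real \<Rightarrow> real) \<Rightarrow> real" where
  "I f = integral {0..1} (\<lambda>t. f t * v t)"

text \<open>The relation \<open>f' = df/ds\<close> with the weight multiplied across.\<close>

definition arc_deriv :: "(real \<Rightarrow> real) \<Rightarrow> (real \<Rightarrow> real) \<Rightarrow> bool" where
  "arc_deriv f f' \<longleftrightarrow> (\<forall>t. (f has_real_derivative f' t * v t) (at t))"

abbreviation cts :: "(real \<Rightarrow> real) \<Rightarrow> bool" where
  "cts f \<equiv> continuous_on {0..1} f"

lemma integrable_weighted: "cts f \<Longrightarrow> (\<lambda>t. f t * v t) integrable_on {0..1}"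
  by (intro integrable_continuous_interval continuous_intros v_cont)

lemma I_add: "cts f \<Longrightarrow> cts g \<Longrightarrow> I (\<lambda>t. f t + g t) = I f + I g"
  unfolding I_def by (simp add: distrib_right integral_add integrable_weighted)

lemma I_diff: "cts f \<Longrightarrow> cts g \<Longrightarrow> I (\<lambda>t. f t - g t) = I f - I g"
  unfolding I_def by (simp add: left_diff_distrib integral_diff integrable_weighted)

lemma I_cmult: "I (\<lambda>t. c * f t) = c * I f"
  unfolding I_def by (simp add: mult.assoc)

lemma I_minus: "I (\<lambda>t. - f t) = - I f"
  using I_cmult[of "-1" f] by simp

lemma I_const: "I (\<lambda>t. c) = c"
  unfolding I_def using v_unit by simp

lemma I_sum: "finite A \<Longrightarrow> (\<And>r. r \<in> A \<Longrightarrow> cts (f r)) \<Longrightarrow> I (\<lambda>t. \<Sum>r\<in>A. f r t) = (\<Sum>r\<in>A. I (f r))"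
  unfolding I_def by (simp add: sum_distrib_right integral_sum integrable_weighted)

lemma I_mono:
  assumes "cts f" "cts g" "\<And>t. t \<in> {0..1} \<Longrightarrow> f t \<le> g t"
  shows "I f \<le> I g"
  unfolding I_def
  by (intro integral_le integrable_weighted assms mult_right_mono less_imp_le[OF v_pos])

lemma I_le_const: "cts f \<Longrightarrow> (\<And>t. t \<in> {0..1} \<Longrightarrow> f t \<le> c) \<Longrightarrow> I f \<le> c"
  using I_mono[of f "\<lambda>_. c"] by (simp add: I_const)

lemma I_abs_le:
  assumes "cts f" shows "\<bar>I f\<bar> \<le> I (\<lambda>t. \<bar>f t\<bar>)"
proof -
  have c: "cts (\<lambda>t. \<bar>f t\<bar>)" "cts (\<lambda>t. - f t)" using assms by (auto intro!: continuous_intros)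
  have "I f \<le> I (\<lambda>t. \<bar>f t\<bar>)" "I (\<lambda>t. - f t) \<le> I (\<lambda>t. \<bar>f t\<bar>)"
    using assms c by (auto intro: I_mono)
  then show ?thesis by (simp add: I_minus)
qed

lemma I_abs_le_const: "cts f \<Longrightarrow> (\<And>t. t \<in> {0..1} \<Longrightarrow> \<bar>f t\<bar> \<le> c) \<Longrightarrow> \<bar>I f\<bar> \<le> c"
  using I_abs_le[of f] I_le_const[of "\<lambda>t. \<bar>f t\<bar>" c] by (force intro: continuous_intros)

text \<open>Cauchy-Schwarz against the constant 1, for total mass 1: integrate
  \<open>(\<bar>f t\<bar> - c)\<^sup>2 \<ge> 0\<close> with \<open>c\<close> the mean of
  \<open>\<bar>f\<bar>\<close>.\<close>

lemma I_abs_square_le: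
  assumes "cts f" shows "(I (\<lambda>t. \<bar>f t\<bar>))\<^sup>2 \<le> I (\<lambda>t. (f t)\<^sup>2)"
proof -
  define c where "c = I (\<lambda>t. \<bar>f t\<bar>)"
  have ct: "cts (\<lambda>t. (2 * c) * \<bar>f t\<bar>)" "cts (\<lambda>t. (f t)\<^sup>2)" "cts (\<lambda>t. (f t)\<^sup>2 - (2 * c) * \<bar>f t\<bar>)"
    using assms by (auto intro!: continuous_intros)
  have "- c\<^sup>2 \<le> I (\<lambda>t. (f t)\<^sup>2 - (2 * c) * \<bar>f t\<bar>)"
  proof -
    have "- c\<^sup>2 \<le> (f t)\<^sup>2 - (2 * c) * \<bar>f t\<bar>" for t
      using zero_le_power2[of "\<bar>f t\<bar> - c"] by (simp add: power2_diff mult.commute mult.left_commute)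
    then show ?thesis using I_mono[of "\<lambda>_. - c\<^sup>2", OF _ ct(3)] by (simp add: I_const)
  qed
  also have "\<dots> = I (\<lambda>t. (f t)\<^sup>2) - 2 * c\<^sup>2"
    using I_diff[OF ct(2,1)] I_cmult[of "2 * c" "\<lambda>t. \<bar>f t\<bar>"] by (simp add: c_def power2_eq_square)
  finally show ?thesis by (simp add: c_def)
qed

lemma zero_of_I_zero:
  assumes f: "cts f" and z: "I f = 0"
  obtains s where "s \<in> {0..1}" "f s = 0"
proof -
  \<comment> \<open>If \<open>g\<close> were positive, its minimum on the compact interval would be
    a positive lower bound for \<open>I g\<close>. Applied to \<open>f\<close> and to
    \<open>- f\<close>, this yields both signs for the intermediate value theorem.\<close>
  have pos: "\<exists>s\<in>{0..1}. g s \<le> 0" if g: "cts g" "I g = 0" for g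
  proof (rule ccontr)
    assume "\<not> ?thesis"
    then have gp: "\<And>t. t \<in> {0..1} \<Longrightarrow> 0 < g t" by force
    obtain x where x: "x \<in> {0..1}" "\<And>y. y \<in> {0..1} \<Longrightarrow> g x \<le> g y"
      using continuous_attains_inf[OF compact_Icc _ g(1)] by auto
    show False using I_mono[of "\<lambda>_. g x" g] g x gp[OF x(1)] by (simp add: I_const)
  qed
  obtain a where a: "a \<in> {0..1}" "f a \<le> 0" using pos[OF f z] by auto
  obtain b where b: "b \<in> {0..1}" "0 \<le> f b"
    using pos[of "\<lambda>t. - f t"] f z by (auto simp: I_minus continuous_on_minus)
  have "0 \<in> f ` {0..1}"
    using connected_continuous_image[OF f] a b
    by (meson connected_Icc connectedD_interval image_eqI)
  then show ?thesis using that by auto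
qed

lemma arc_deriv_cts: "arc_deriv f f' \<Longrightarrow> cts f"
  unfolding arc_deriv_def by (meson DERIV_isCont continuous_at_imp_continuous_on)

lemma arc_deriv_has_integral:
  assumes "arc_deriv f f'" "a \<le> b"
  shows "((\<lambda>t. f' t * v t) has_integral (f b - f a)) {a..b}"
  using assms unfolding arc_deriv_def
  by (intro fundamental_theorem_of_calculus)
     (auto simp: has_real_derivative_iff_has_vector_derivative[symmetric] intro: has_field_derivative_at_within)

lemma I_arc_deriv: "arc_deriv f f' \<Longrightarrow> f 1 = f 0 \<Longrightarrow> I f' = 0"
  unfolding I_def using arc_deriv_has_integral[of f f' 0 1] by (auto dest: integral_unique)

lemma arc_deriv_mult: "arc_deriv f f' \<Longrightarrow> arc_deriv g g' \<Longrightarrow> arc_deriv (\<lambda>t. f t * g t) (\<lambda>t. f' t * g t + f t * g' t)"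
  unfolding arc_deriv_def by (auto intro!: derivative_eq_intros simp: algebra_simps)

text \<open>Equal end values cancel the boundary term.\<close>

lemma I_by_parts:
  assumes "arc_deriv f f'" "arc_deriv g g'" "f 1 = f 0" "g 1 = g 0" "cts f'" "cts g'"
  shows "I (\<lambda>t. f' t * g t) = - I (\<lambda>t. f t * g' t)"
proof -
  have "I (\<lambda>t. f' t * g t + f t * g' t) = 0"
    using I_arc_deriv[OF arc_deriv_mult[OF assms(1,2)]] assms(3,4) by simp
  moreover have "cts f" "cts g" using assms arc_deriv_cts by auto
  ultimately show ?thesis using assms(5,6) by (subst (asm) I_add) (auto intro: continuous_intros)
qed

lemma arc_deriv_diff_le:
  assumes d: "arc_deriv f f'" and c: "cts f'" and s: "s \<in> {0..1}" "t \<in> {0..1}"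
  shows "\<bar>f t - f s\<bar> \<le> I (\<lambda>t. \<bar>f' t\<bar>)"
proof -
  have main: "\<bar>f b - f a\<bar> \<le> I (\<lambda>t. \<bar>f' t\<bar>)" if ab: "0 \<le> a" "a \<le> b" "b \<le> 1" for a b
  proof -
    have ca: "(\<lambda>t. \<bar>f' t\<bar> * v t) integrable_on {0..1}"
      using c by (intro integrable_weighted) (auto intro: continuous_intros)
    have sub: "{a..b} \<subseteq> {0..1}" using ab by auto
    have ci: "(\<lambda>t. \<bar>f' t\<bar> * v t) integrable_on {a..b}"
      using ca sub by (rule integrable_on_subinterval)
    have "\<bar>f b - f a\<bar> = norm (integral {a..b} (\<lambda>t. f' t * v t))"
      using arc_deriv_has_integral[OF d ab(2)] by (simp add: integral_unique)
    also have "\<dots> \<le> integral {a..b} (\<lambda>t. \<bar>f' t\<bar> * v t)"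
      using arc_deriv_has_integral[OF d ab(2)] ci less_imp_le[OF v_pos]
      by (intro integral_norm_bound_integral) (auto simp: abs_mult)
    also have "\<dots> \<le> I (\<lambda>t. \<bar>f' t\<bar>)" unfolding I_def
      using ca ci sub less_imp_le[OF v_pos] by (intro integral_subset_le) auto
    finally show ?thesis .
  qed
  show ?thesis using main[of s t] main[of t s] s by (cases "s \<le> t") (auto simp: abs_minus_commute)
qed

text \<open>A function of mean zero vanishes somewhere, and its variation from that zero is at most
  the integral of \<open>\<bar>f'\<bar>\<close>.\<close>

lemma poincare_sup:
  assumes "arc_deriv f f'" "cts f'" "I f = 0" "t \<in> {0..1}"
  shows "\<bar>f t\<bar> \<le> I (\<lambda>t. \<bar>f' t\<bar>)"
  using zero_of_I_zero[OF arc_deriv_cts[OF assms(1)] assms(3)] arc_deriv_diff_le[OF assms(1,2) _ assms(4)]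
  by (metis diff_zero)

end

section \<open>Closed curves of unit length\<close>

text \<open>The length of the curve is normalised to 1; \<open>k j\<close> is the \<open>j\<close>-th arclength derivative of the
  curvature, \<open>(X, Y)\<close> the unit tangent, and \<open>\<kappa>\<close> is \<open>2 * pi\<close> times the turning number.\<close>

locale closed_curve_frame = unit_weight +
  fixes k :: "nat \<Rightarrow> real \<Rightarrow> real" and X Y :: "real \<Rightarrow> real" and \<kappa> :: real and m :: nat
  assumes k_deriv: "\<And>j. arc_deriv (k j) (k (Suc j))"
    and k_per: "\<And>j. k j 1 = k j 0"
    and X_deriv: "arc_deriv X (\<lambda>t. - k 0 t * Y t)"
    and Y_deriv: "arc_deriv Y (\<lambda>t. k 0 t * X t)"
    and X_per: "X 1 = X 0" and Y_per: "Y 1 = Y 0"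
    and unit: "\<And>t. (X t)\<^sup>2 + (Y t)\<^sup>2 = 1"
    and X_zero: "I X = 0" and Y_zero: "I Y = 0"
    and k_total: "I (k 0) = \<kappa>" and \<kappa>_nz: "\<kappa> \<noteq> 0"
    and m_pos: "m \<ge> 1"
begin

section \<open>The energy gradient and its translation current\<close>

definition K :: "real \<Rightarrow> real" where
  "K = (\<lambda>t. (-1) ^ (m + 1) * k (2 * m + 2) t - k 0 t * (k m t)\<^sup>2 / 2
      + k 0 t * (\<Sum>r = 1..m. (-1) ^ (r + 1) * k (m - r) t * k (m + r) t))"

definition F :: "real \<Rightarrow> real" where
  "F = (\<lambda>t. (\<Sum>r = 1..m. (-1) ^ (r + 1) * k (m - r) t * k (m + r) t) - (k m t)\<^sup>2 / 2)"

definition G :: "real \<Rightarrow> real" where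
  "G = (\<lambda>t. (-1) ^ (m + 1) * k (2 * m + 1) t)"

lemma k_cts [continuous_intros]: "cts (k j)"
  using k_deriv arc_deriv_cts by blast

lemma XY_cts [continuous_intros]: "cts X" "cts Y"
  using X_deriv Y_deriv arc_deriv_cts by blast+

lemma K_cts [continuous_intros]: "cts K" and F_cts [continuous_intros]: "cts F"
  unfolding K_def F_def by (auto intro!: continuous_intros)

lemma XY_le: "\<bar>X t\<bar> \<le> 1" "\<bar>Y t\<bar> \<le> 1"
proof -
  have "(X t)\<^sup>2 \<le> 1" "(Y t)\<^sup>2 \<le> 1"
    using unit[of t] zero_le_power2[of "X t"] zero_le_power2[of "Y t"] by linarith+
  then show "\<bar>X t\<bar> \<le> 1" "\<bar>Y t\<bar> \<le> 1" by (simp_all add: abs_square_le_1)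
qed

text \<open>Differentiating the alternating sum telescopes. At the lower end
  \<open>k m * k (m + 1)\<close> survives and is removed by the derivative of
  \<open>(k m)\<^sup>2 / 2\<close>; at the upper end \<open>k 0 * k (2 * m + 1)\<close> remains, up
  to sign.\<close>

lemma F_deriv: "arc_deriv F (\<lambda>t. k 0 t * G t)"
proof -
  have tele: "(\<Sum>r = 1..n. (-1) ^ (r + 1) * (k (Suc (m - r)) t * k (m + r) t + k (m - r) t * k (Suc (m + r)) t))
      = k m t * k (Suc m) t + (-1) ^ (n + 1) * k (m - n) t * k (Suc (m + n)) t" if "n \<le> m" for n t
    using that
  proof (induction n)
    case (Suc n)
    \<comment> \<open>The neighbouring terms match only while the natural subtraction does not
      truncate, hence the restriction \<open>n \<le> m\<close>.\<close>
    then have "Suc (m - Suc n) = m - n" by simp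
    then show ?case using Suc by (simp add: algebra_simps)
  qed simp
  have kd: "(k j has_real_derivative k (Suc j) t * v t) (at t)" for j t
    using k_deriv unfolding arc_deriv_def by blast
  have "(F has_real_derivative k 0 t * G t * v t) (at t)" for t
  proof -
    have "(F has_real_derivative
        (\<Sum>r = 1..m. (-1) ^ (r + 1) * (k (Suc (m - r)) t * k (m + r) t + k (m - r) t * k (Suc (m + r)) t)) * v t
        - k m t * k (Suc m) t * v t) (at t)"
      unfolding F_def
      by (auto intro!: derivative_eq_intros kd sum.cong simp: sum_distrib_left algebra_simps)
    then show ?thesis unfolding tele[OF order_refl] by (simp add: G_def algebra_simps mult_2 mult_2_right)
  qed
  then show ?thesis unfolding arc_deriv_def by blast
qed

lemma G_deriv: "arc_deriv G (\<lambda>t. K t - k 0 t * F t)"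
proof -
  have "(k (2*m+1) has_real_derivative k (2*m+2) t * v t) (at t)" for t
    using k_deriv[of "2*m+1"] unfolding arc_deriv_def by simp
  moreover have "K t - k 0 t * F t = (-1) ^ (m + 1) * k (2 * m + 2) t" for t
    unfolding K_def F_def by (simp add: algebra_simps)
  ultimately show ?thesis unfolding G_def arc_deriv_def
    by (auto intro!: derivative_eq_intros)
qed

text \<open>The Noether current of translation invariance: \<open>J = F T + G N\<close> satisfies \<open>J' = K N\<close>.\<close>

definition J1 :: "real \<Rightarrow> real" where "J1 = (\<lambda>t. F t * X t - G t * Y t)"
definition J2 :: "real \<Rightarrow> real" where "J2 = (\<lambda>t. F t * Y t + G t * X t)"

lemma J1_deriv: "arc_deriv J1 (\<lambda>t. - K t * Y t)" and J2_deriv: "arc_deriv J2 (\<lambda>t. K t * X t)"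
  using F_deriv G_deriv X_deriv Y_deriv unfolding J1_def J2_def arc_deriv_def
  by (auto intro!: derivative_eq_intros simp: algebra_simps)

text \<open>\<open>F\<close> is the tangential component of \<open>J\<close>, as
  \<open>(X, Y)\<close> is a unit vector.\<close>

lemma F_eq_J: "F t = J1 t * X t + J2 t * Y t"
proof -
  have "J1 t * X t + J2 t * Y t = F t * ((X t)\<^sup>2 + (Y t)\<^sup>2)"
    unfolding J1_def J2_def by (simp add: algebra_simps power2_eq_square)
  then show ?thesis by (simp add: unit)
qed

definition K1 :: real where "K1 = I (\<lambda>t. \<bar>K t\<bar>)"

text \<open>The approximation to \<open>F\<close> obtained by freezing the current at parameter
  0.\<close>

definition P :: "real \<Rightarrow> real" where "P = (\<lambda>t. J1 0 * X t + J2 0 * Y t)"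

lemma P_cts [continuous_intros]: "cts P"
  unfolding P_def by (intro continuous_intros)

lemma J_diff:
  assumes "t \<in> {0..1}"
  shows "\<bar>J1 t - J1 0\<bar> \<le> K1" "\<bar>J2 t - J2 0\<bar> \<le> K1"
proof -
  have "\<bar>K t\<bar> * \<bar>Y t\<bar> \<le> \<bar>K t\<bar>" "\<bar>K t\<bar> * \<bar>X t\<bar> \<le> \<bar>K t\<bar>" for t
    using mult_left_mono[OF XY_le(1)[of t], of "\<bar>K t\<bar>"] mult_left_mono[OF XY_le(2)[of t], of "\<bar>K t\<bar>"] by auto
  then have "I (\<lambda>t. \<bar>- K t * Y t\<bar>) \<le> K1" "I (\<lambda>t. \<bar>K t * X t\<bar>) \<le> K1"
    unfolding K1_def by (auto intro!: I_mono continuous_intros simp: abs_mult)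
  moreover have "\<bar>J1 t - J1 0\<bar> \<le> I (\<lambda>t. \<bar>- K t * Y t\<bar>)" "\<bar>J2 t - J2 0\<bar> \<le> I (\<lambda>t. \<bar>K t * X t\<bar>)"
    using assms by (intro arc_deriv_diff_le J1_deriv J2_deriv continuous_intros; simp)+
  ultimately show "\<bar>J1 t - J1 0\<bar> \<le> K1" "\<bar>J2 t - J2 0\<bar> \<le> K1" by linarith+
qed

lemma F_minus_P:
  assumes "t \<in> {0..1}" shows "\<bar>F t - P t\<bar> \<le> 2 * K1"
proof -
  have "F t - P t = (J1 t - J1 0) * X t + (J2 t - J2 0) * Y t"
    unfolding F_eq_J P_def by (simp add: algebra_simps)
  moreover have "\<bar>(J1 t - J1 0) * X t\<bar> \<le> K1 * 1" "\<bar>(J2 t - J2 0) * Y t\<bar> \<le> K1 * 1"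
    unfolding abs_mult by (intro mult_mono J_diff[OF assms] XY_le; use J_diff[OF assms] in force)+
  ultimately show ?thesis by linarith
qed

section \<open>The integral of \<open>F\<close> and the first bound on the energy\<close>

definition E :: real where "E = I (\<lambda>t. (k m t)\<^sup>2)"

text \<open>Each of \<open>r\<close> integrations by parts moves one derivative across and flips the
  sign.\<close>

lemma I_k_k: "r \<le> m \<Longrightarrow> I (\<lambda>t. k (m - r) t * k (m + r) t) = (-1) ^ r * E"
proof (induction r)
  case 0 then show ?case by (simp add: E_def power2_eq_square)
next
  case (Suc r)
  have "arc_deriv (k (m - Suc r)) (k (m - r))" using k_deriv[of "m - Suc r"] Suc.prems
    by (simp add: Suc_diff_Suc)
  then have "I (\<lambda>t. k (m - r) t * k (m + r) t) = - I (\<lambda>t. k (m - Suc r) t * k (Suc (m + r)) t)"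
    by (intro I_by_parts k_deriv k_per k_cts)
  then show ?case using Suc by simp
qed

text \<open>The signs in \<open>F\<close> are opposite to those of \<open>I_k_k\<close>, so all
  \<open>m\<close> summands contribute \<open>- E\<close>, and the square adds
  \<open>- E / 2\<close>.\<close>

lemma I_F: "I F = - (real m + 1/2) * E"
proof -
  have s: "I (\<lambda>t. \<Sum>r = 1..m. (-1) ^ (r + 1) * k (m - r) t * k (m + r) t) = - real m * E"
  proof -
    have "I (\<lambda>t. (-1) ^ (r + 1) * k (m - r) t * k (m + r) t) = - E" if "r \<in> {1..m}" for r
    proof -
      have "I (\<lambda>t. (-1) ^ (r + 1) * k (m - r) t * k (m + r) t) = (-1) ^ (r + 1) * ((-1) ^ r * E)"
        using I_cmult[of "(-1) ^ (r + 1)" "\<lambda>t. k (m - r) t * k (m + r) t"] I_k_k[of r] that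
        by (simp add: mult.assoc)
      then show ?thesis by (simp flip: power_add mult.assoc)
    qed
    then show ?thesis by (subst I_sum) (auto intro!: continuous_intros)
  qed
  have "I F = - real m * E - I (\<lambda>t. (1/2) * (k m t)\<^sup>2)"
    unfolding F_def s[symmetric] by (subst I_diff) (auto intro!: continuous_intros)
  also have "\<dots> = - (real m + 1/2) * E" unfolding I_cmult E_def[symmetric] by (simp add: algebra_simps)
  finally show ?thesis .
qed

lemma E_nonneg: "E \<ge> 0" and K1_nonneg: "K1 \<ge> 0"
  using I_mono[of "\<lambda>_. 0" "\<lambda>t. (k m t)\<^sup>2"] I_mono[of "\<lambda>_. 0" "\<lambda>t. \<bar>K t\<bar>"]
  by (auto simp: E_def K1_def I_const intro!: continuous_intros)

text \<open>Closedness kills the constant part of \<open>J\<close> in \<open>\<integral> F = \<integral> J \<bullet> T\<close>.\<close>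

lemma E_le_K1: "E \<le> 2 * K1"
proof -
  have "I P = 0" unfolding P_def by (subst I_add) (auto simp: I_cmult X_zero Y_zero intro!: continuous_intros)
  then have "I F = I (\<lambda>t. F t - P t)" by (subst I_diff) (auto intro!: continuous_intros)
  then have "\<bar>I F\<bar> \<le> 2 * K1" using F_minus_P by (auto intro!: I_abs_le_const continuous_intros)
  then have "(real m + 1/2) * E \<le> 2 * K1" unfolding I_F by (simp add: abs_mult E_nonneg flip: minus_add_distrib)
  moreover have "1 * E \<le> (real m + 1/2) * E" using m_pos E_nonneg by (intro mult_right_mono) auto
  ultimately show ?thesis by linarith
qed

section \<open>Curvature close to its mean\<close>

definition \<phi> :: "nat \<Rightarrow> real \<Rightarrow> real" where
  "\<phi> j = (if j = 0 then (\<lambda>t. k 0 t - \<kappa>) else k j)"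

definition \<epsilon> :: real where "\<epsilon> = sqrt E"

text \<open>Subtracting the constant \<open>\<kappa>\<close> from \<open>k 0\<close> leaves all
  derivatives unchanged, so the \<open>\<phi> j\<close> form one chain of derivatives, now with mean
  zero at every level.\<close>

lemma \<phi>_deriv: "arc_deriv (\<phi> j) (\<phi> (Suc j))"
  using k_deriv[of j] unfolding \<phi>_def arc_deriv_def by (auto intro!: derivative_eq_intros)

lemma \<phi>_cts [continuous_intros]: "cts (\<phi> j)"
  using \<phi>_deriv arc_deriv_cts by blast

lemma \<phi>_per: "\<phi> j 1 = \<phi> j 0"
  by (simp add: \<phi>_def k_per)

lemma I_\<phi>: "I (\<phi> j) = 0"
proof (cases j)
  case 0 then show ?thesis by (simp add: \<phi>_def I_diff I_const k_total k_cts)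
next
  case (Suc i) then show ?thesis using I_arc_deriv[OF \<phi>_deriv \<phi>_per] by simp
qed

lemma \<phi>_le: "t \<in> {0..1} \<Longrightarrow> \<bar>\<phi> j t\<bar> \<le> I (\<lambda>t. \<bar>\<phi> (Suc j) t\<bar>)"
  by (intro poincare_sup \<phi>_deriv \<phi>_cts I_\<phi>)

lemma I_abs_\<phi>_mono: "i \<le> j \<Longrightarrow> I (\<lambda>t. \<bar>\<phi> i t\<bar>) \<le> I (\<lambda>t. \<bar>\<phi> j t\<bar>)"
proof (induction rule: dec_induct)
  case (step n)
  have "I (\<lambda>t. \<bar>\<phi> n t\<bar>) \<le> I (\<lambda>t. \<bar>\<phi> (Suc n) t\<bar>)"
    by (intro I_le_const \<phi>_le) (auto intro!: continuous_intros)
  then show ?case using step by simp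
qed simp

lemma I_abs_\<phi>_m: "I (\<lambda>t. \<bar>\<phi> m t\<bar>) \<le> \<epsilon>"
  using I_abs_square_le[OF \<phi>_cts[of m]] m_pos by (simp add: \<phi>_def \<epsilon>_def E_def real_le_rsqrt)

text \<open>The sup norm at level \<open>j\<close> is controlled by the mean of the absolute value
  at level \<open>j + 1\<close>, and these means increase up to level \<open>m\<close>. Hence the
  strict inequality \<open>j < m\<close>.\<close>

lemma \<phi>_le_\<epsilon>: "j < m \<Longrightarrow> t \<in> {0..1} \<Longrightarrow> \<bar>\<phi> j t\<bar> \<le> \<epsilon>"
  using \<phi>_le[of t j] I_abs_\<phi>_mono[of "Suc j" m] I_abs_\<phi>_m by simp

lemma \<epsilon>_nonneg: "\<epsilon> \<ge> 0"
  by (simp add: \<epsilon>_def E_nonneg)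

text \<open>\<open>k 0 * X\<close> and \<open>- k 0 * Y\<close> are the arclength derivatives of
  \<open>Y\<close> and \<open>X\<close>; the part with \<open>\<kappa>\<close> vanishes because the
  tangent integrates to zero.\<close>

lemma I_k_tangent: "I (\<lambda>t. \<phi> 0 t * X t) = 0" "I (\<lambda>t. \<phi> 0 t * Y t) = 0"
proof -
  have "I (\<lambda>t. k 0 t * X t) = 0" using I_arc_deriv[OF Y_deriv Y_per] .
  moreover have "I (\<lambda>t. k 0 t * Y t) = 0"
    using I_arc_deriv[OF X_deriv X_per] I_minus[of "\<lambda>t. k 0 t * Y t"] by simp
  moreover have "I (\<lambda>t. k 0 t * Z t - \<kappa> * Z t) = I (\<lambda>t. k 0 t * Z t) - \<kappa> * I Z" if "cts Z" for Z
    using that by (subst I_diff) (auto simp: I_cmult intro!: continuous_intros)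
  ultimately show "I (\<lambda>t. \<phi> 0 t * X t) = 0" "I (\<lambda>t. \<phi> 0 t * Y t) = 0"
    using X_zero Y_zero XY_cts by (simp_all add: \<phi>_def left_diff_distrib)
qed

text \<open>For a small deviation of the curvature, the second moment matrix of the tangent is close
  to half the identity. This makes testing against \<open>X\<close> and \<open>Y\<close>
  nondegenerate in \<open>J0_le\<close>.\<close>

lemma second_moments:
  "\<bar>\<kappa>\<bar> * \<bar>I (\<lambda>t. (X t)\<^sup>2 - (Y t)\<^sup>2)\<bar> \<le> \<epsilon>" "\<bar>\<kappa>\<bar> * \<bar>I (\<lambda>t. X t * Y t)\<bar> \<le> \<epsilon>"
proof -
  have bound: "\<bar>\<kappa>\<bar> * \<bar>I h\<bar> \<le> \<epsilon>" if h: "cts h" "I (\<lambda>t. k 0 t * h t) = 0" "\<And>t. \<bar>h t\<bar> \<le> 1" for h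
  proof -
    have "\<kappa> * I h = I (\<lambda>t. k 0 t * h t - \<phi> 0 t * h t)"
      by (simp add: \<phi>_def left_diff_distrib I_cmult)
    also have "\<dots> = - I (\<lambda>t. \<phi> 0 t * h t)"
      using h by (subst I_diff) (auto intro!: continuous_intros)
    finally have "\<bar>\<kappa>\<bar> * \<bar>I h\<bar> = \<bar>I (\<lambda>t. \<phi> 0 t * h t)\<bar>" by (metis abs_minus abs_mult)
    also have "\<dots> \<le> \<epsilon> * 1"
    proof (rule I_abs_le_const)
      fix t :: real assume "t \<in> {0..1}"
      then have "\<bar>\<phi> 0 t\<bar> \<le> \<epsilon>" using \<phi>_le_\<epsilon> m_pos by simp
      then show "\<bar>\<phi> 0 t * h t\<bar> \<le> \<epsilon> * 1"
        unfolding abs_mult by (rule mult_mono[OF _ h(3)]) (auto simp: \<epsilon>_nonneg)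
    qed (use h in \<open>auto intro!: continuous_intros\<close>)
    finally show ?thesis by simp
  qed
  \<comment> \<open>Periodic primitives of \<open>k 0 * h\<close> for both choices of
    \<open>h\<close>; thus \<open>k 0 * h\<close> has integral zero, and replacing
    \<open>k 0\<close> by \<open>\<kappa>\<close> costs at most \<open>\<epsilon>\<close>.\<close>
  have d: "arc_deriv (\<lambda>t. X t * Y t) (\<lambda>t. k 0 t * ((X t)\<^sup>2 - (Y t)\<^sup>2))"
    "arc_deriv (\<lambda>t. - (X t * X t) / 2) (\<lambda>t. k 0 t * (X t * Y t))"
    using X_deriv Y_deriv unfolding arc_deriv_def
    by (auto intro!: derivative_eq_intros simp: algebra_simps power2_eq_square)
  have "I (\<lambda>t. k 0 t * ((X t)\<^sup>2 - (Y t)\<^sup>2)) = 0" "I (\<lambda>t. k 0 t * (X t * Y t)) = 0"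
    using I_arc_deriv[OF d(1)] I_arc_deriv[OF d(2)] X_per Y_per by auto
  moreover have "\<bar>(X t)\<^sup>2 - (Y t)\<^sup>2\<bar> \<le> 1" for t
    using unit[of t] zero_le_power2[of "X t"] zero_le_power2[of "Y t"] by linarith
  moreover have "\<bar>X t * Y t\<bar> \<le> 1" for t
    using mult_mono[OF XY_le(1)[of t] XY_le(2)[of t]] by (simp add: abs_mult)
  ultimately show "\<bar>\<kappa>\<bar> * \<bar>I (\<lambda>t. (X t)\<^sup>2 - (Y t)\<^sup>2)\<bar> \<le> \<epsilon>" "\<bar>\<kappa>\<bar> * \<bar>I (\<lambda>t. X t * Y t)\<bar> \<le> \<epsilon>"
    by (auto intro!: bound continuous_intros)
qed

text \<open>The first summand is \<open>\<bar>\<kappa>\<bar>\<close> times the constant of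
  \<open>I_\<phi>_tangent\<close> at \<open>j = 2 * m\<close>, the 1 pays for replacing
  \<open>k 0\<close> by \<open>\<kappa>\<close>, and \<open>real m\<close> is the error of
  \<open>F_principal\<close>.\<close>

definition B :: real where "B = \<bar>\<kappa>\<bar> * (1 + \<bar>\<kappa>\<bar>) ^ (2 * m) + 1 + real m"

section \<open>Estimates relative to a bound \<open>U\<close> for the derivative of order
  \<open>2 * m\<close>\<close>

context
  fixes U :: real
  assumes U: "\<And>t. t \<in> {0..1} \<Longrightarrow> \<bar>k (2 * m) t\<bar> \<le> U"
begin

text \<open>Iterating the Poincare inequality passes the bound at level \<open>2 * m\<close> down to
  all lower levels.\<close>

lemma \<phi>_le_U:
  assumes "j \<le> 2 * m" "t \<in> {0..1}" shows "\<bar>\<phi> j t\<bar> \<le> U"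
proof (cases "j = 2 * m")
  case True then show ?thesis using U assms m_pos by (simp add: \<phi>_def)
next
  case False
  have "I (\<lambda>t. \<bar>\<phi> (2 * m) t\<bar>) \<le> U"
    using U m_pos by (intro I_le_const continuous_intros) (auto simp: \<phi>_def)
  then show ?thesis
    using \<phi>_le[OF assms(2), of j] I_abs_\<phi>_mono[of "Suc j" "2 * m"] False assms(1) by simp
qed

lemma k_le_U: "1 \<le> j \<Longrightarrow> j \<le> 2 * m \<Longrightarrow> t \<in> {0..1} \<Longrightarrow> \<bar>k j t\<bar> \<le> U"
  using \<phi>_le_U[of j t] by (simp add: \<phi>_def)

lemma U_nonneg: "U \<ge> 0"
  using U[of 0] by simp

text \<open>Induction on \<open>j\<close>: integrating by parts turns the tangent into
  \<open>k 0\<close> times the normal. Splitting \<open>k 0 = \<kappa> + \<phi> 0\<close> gives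
  \<open>\<kappa>\<close> times the previous moment and a product bounded by
  \<open>\<epsilon> * U\<close>. At \<open>j = 0\<close> the moments vanish exactly.\<close>

lemma I_\<phi>_tangent:
  "j \<le> 2 * m \<Longrightarrow> \<bar>I (\<lambda>t. \<phi> j t * X t)\<bar> \<le> (1 + \<bar>\<kappa>\<bar>) ^ j * (\<epsilon> * U)
    \<and> \<bar>I (\<lambda>t. \<phi> j t * Y t)\<bar> \<le> (1 + \<bar>\<kappa>\<bar>) ^ j * (\<epsilon> * U)"
proof (induction j)
  case 0 then show ?case using I_k_tangent \<epsilon>_nonneg U_nonneg by simp
next
  case (Suc j)
  have step: "\<bar>I (\<lambda>t. \<phi> j t * (k 0 t * Z t))\<bar> \<le> (1 + \<bar>\<kappa>\<bar>) ^ Suc j * (\<epsilon> * U)"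
    if Z: "cts Z" "\<And>t. \<bar>Z t\<bar> \<le> 1" "\<bar>I (\<lambda>t. \<phi> j t * Z t)\<bar> \<le> (1 + \<bar>\<kappa>\<bar>) ^ j * (\<epsilon> * U)" for Z
  proof -
    have "I (\<lambda>t. \<phi> j t * (k 0 t * Z t)) = I (\<lambda>t. \<kappa> * (\<phi> j t * Z t) + \<phi> 0 t * \<phi> j t * Z t)"
      by (rule arg_cong[where f=I]) (auto simp: \<phi>_def fun_eq_iff algebra_simps)
    also have "\<dots> = \<kappa> * I (\<lambda>t. \<phi> j t * Z t) + I (\<lambda>t. \<phi> 0 t * \<phi> j t * Z t)"
      using Z(1) by (subst I_add) (auto simp: I_cmult intro!: continuous_intros)
    finally have "\<bar>I (\<lambda>t. \<phi> j t * (k 0 t * Z t))\<bar>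
        \<le> \<bar>\<kappa>\<bar> * \<bar>I (\<lambda>t. \<phi> j t * Z t)\<bar> + \<bar>I (\<lambda>t. \<phi> 0 t * \<phi> j t * Z t)\<bar>"
      by (metis abs_mult abs_triangle_ineq)
    also have "\<bar>I (\<lambda>t. \<phi> 0 t * \<phi> j t * Z t)\<bar> \<le> \<epsilon> * U * 1"
    proof (rule I_abs_le_const)
      fix t :: real assume t: "t \<in> {0..1}"
      show "\<bar>\<phi> 0 t * \<phi> j t * Z t\<bar> \<le> \<epsilon> * U * 1" unfolding abs_mult
        using Suc.prems m_pos t \<epsilon>_nonneg U_nonneg Z(2) by (intro mult_mono \<phi>_le_\<epsilon> \<phi>_le_U) auto
    qed (use Z(1) in \<open>auto intro!: continuous_intros\<close>)
    also have "\<bar>\<kappa>\<bar> * \<bar>I (\<lambda>t. \<phi> j t * Z t)\<bar> \<le> \<bar>\<kappa>\<bar> * ((1 + \<bar>\<kappa>\<bar>) ^ j * (\<epsilon> * U))"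
      by (intro mult_left_mono Z(3)) auto
    \<comment> \<open>Since \<open>(1 + \<bar>\<kappa>\<bar>) ^ j \<ge> 1\<close>, the new error
      fits into one more factor \<open>1 + \<bar>\<kappa>\<bar>\<close>.\<close>
    also have "\<bar>\<kappa>\<bar> * ((1 + \<bar>\<kappa>\<bar>) ^ j * (\<epsilon> * U)) + \<epsilon> * U * 1
        \<le> \<bar>\<kappa>\<bar> * ((1 + \<bar>\<kappa>\<bar>) ^ j * (\<epsilon> * U)) + (1 + \<bar>\<kappa>\<bar>) ^ j * (\<epsilon> * U)"
      using mult_right_mono[of 1 "(1 + \<bar>\<kappa>\<bar>) ^ j" "\<epsilon> * U"] \<epsilon>_nonneg U_nonneg by simp
    finally show ?thesis by (simp add: algebra_simps)
  qed
  have "I (\<lambda>t. \<phi> (Suc j) t * X t) = - I (\<lambda>t. \<phi> j t * (- k 0 t * Y t))"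
    by (intro I_by_parts \<phi>_deriv X_deriv X_per \<phi>_per continuous_intros)
  then have "I (\<lambda>t. \<phi> (Suc j) t * X t) = I (\<lambda>t. \<phi> j t * (k 0 t * Y t))"
    by (simp flip: I_minus)
  moreover have "I (\<lambda>t. \<phi> (Suc j) t * Y t) = - I (\<lambda>t. \<phi> j t * (k 0 t * X t))"
    by (intro I_by_parts \<phi>_deriv Y_deriv Y_per \<phi>_per continuous_intros)
  ultimately show ?case using step[of X] step[of Y] XY_le XY_cts Suc by simp
qed

text \<open>A pointwise bound by \<open>\<epsilon> * U\<close> although \<open>k m\<close> is only small in mean: integrate
  \<open>(k m ^ 2)' = 2 * k m * k (m + 1)\<close> from a zero of \<open>k m\<close>.\<close>

lemma k_m_square_le:
  assumes t: "t \<in> {0..1}" shows "(k m t)\<^sup>2 \<le> 2 * (\<epsilon> * U)"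
proof -
  have \<phi>m: "\<phi> m = k m" using m_pos by (simp add: \<phi>_def)
  obtain s where s: "s \<in> {0..1}" "k m s = 0"
    using zero_of_I_zero[OF k_cts, of m] I_\<phi>[of m] \<phi>m by auto
  have "(k m t)\<^sup>2 = \<bar>k m t * k m t - k m s * k m s\<bar>" using s by (simp add: power2_eq_square)
  also have "\<dots> \<le> I (\<lambda>t. \<bar>k (Suc m) t * k m t + k m t * k (Suc m) t\<bar>)"
    by (intro arc_deriv_diff_le[OF arc_deriv_mult[OF k_deriv k_deriv] _ s(1) t] continuous_intros)
  also have "\<dots> \<le> I (\<lambda>t. 2 * U * \<bar>k m t\<bar>)"
  proof (intro I_mono)
    fix r :: real assume r: "r \<in> {0..1}"
    have "\<bar>k (Suc m) r\<bar> * \<bar>k m r\<bar> \<le> U * \<bar>k m r\<bar>"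
      using k_le_U[of "Suc m" r] r m_pos by (intro mult_right_mono) auto
    then show "\<bar>k (Suc m) r * k m r + k m r * k (Suc m) r\<bar> \<le> 2 * U * \<bar>k m r\<bar>"
      by (simp add: mult.commute abs_mult)
  qed (auto intro!: continuous_intros)
  also have "\<dots> = 2 * U * I (\<lambda>t. \<bar>\<phi> m t\<bar>)" by (simp add: I_cmult \<phi>m)
  also have "\<dots> \<le> 2 * U * \<epsilon>" using I_abs_\<phi>_m U_nonneg by (intro mult_left_mono) auto
  finally show ?thesis by (simp add: algebra_simps)
qed

text \<open>The summand \<open>r = m\<close> is the leading term. In each of the other
  \<open>m - 1\<close> summands the lower factor is at most \<open>\<epsilon>\<close> and the higher
  one at most \<open>U\<close>; half the square of \<open>k m\<close> contributes one more
  \<open>\<epsilon> * U\<close>.\<close>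

lemma F_principal:
  assumes t: "t \<in> {0..1}"
  shows "\<bar>F t - (-1) ^ (m + 1) * (k 0 t * k (2 * m) t)\<bar> \<le> real m * (\<epsilon> * U)"
proof -
  obtain n where n: "m = Suc n" using m_pos by (cases m) auto
  define S where "S = (\<Sum>r = 1..n. (-1) ^ (r + 1) * k (m - r) t * k (m + r) t)"
  have "(\<Sum>r = 1..Suc n. (-1) ^ (r + 1) * k (m - r) t * k (m + r) t)
      = S + (-1) ^ (m + 1) * (k 0 t * k (2 * m) t)"
    unfolding S_def by (subst sum.cl_ivl_Suc) (simp add: n mult_2)
  then have eq: "F t - (-1) ^ (m + 1) * (k 0 t * k (2 * m) t) = S - (k m t)\<^sup>2 / 2"
    unfolding F_def using n by simp
  have "\<bar>(-1) ^ (r + 1) * k (m - r) t * k (m + r) t\<bar> \<le> \<epsilon> * U" if r: "r \<in> {1..n}" for r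
  proof -
    have "\<phi> (m - r) = k (m - r)" using r n by (auto simp: \<phi>_def)
    then have "\<bar>k (m - r) t\<bar> \<le> \<epsilon>" using \<phi>_le_\<epsilon>[of "m - r" t] r n t by simp
    moreover have "\<bar>k (m + r) t\<bar> \<le> U" using k_le_U r n t by auto
    ultimately have "\<bar>k (m - r) t\<bar> * \<bar>k (m + r) t\<bar> \<le> \<epsilon> * U" using \<epsilon>_nonneg by (intro mult_mono) auto
    then show ?thesis by (simp add: abs_mult power_abs)
  qed
  then have "\<bar>S\<bar> \<le> (\<Sum>r = 1..n. \<epsilon> * U)" unfolding S_def by (intro order_trans[OF sum_abs sum_mono])
  then have "\<bar>S\<bar> \<le> real n * (\<epsilon> * U)" by simp
  moreover have "(k m t)\<^sup>2 \<le> 2 * (\<epsilon> * U)" by (rule k_m_square_le[OF t])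
  moreover have "real m * (\<epsilon> * U) = real n * (\<epsilon> * U) + \<epsilon> * U"
    using n by (simp add: distrib_right)
  ultimately show ?thesis unfolding eq using zero_le_power2[of "k m t"] by linarith
qed

text \<open>With \<open>k 0\<close> replaced by \<open>\<kappa>\<close>, the leading part of
  \<open>F\<close> is a multiple of \<open>k (2 * m)\<close>, whose tangential moments are small by
  \<open>I_\<phi>_tangent\<close>. The remainder \<open>R\<close> is small pointwise.\<close>

lemma I_F_tangent: "\<bar>I (\<lambda>t. F t * X t)\<bar> \<le> B * (\<epsilon> * U)" "\<bar>I (\<lambda>t. F t * Y t)\<bar> \<le> B * (\<epsilon> * U)"
proof -
  have main: "\<bar>I (\<lambda>t. F t * Z t)\<bar> \<le> B * (\<epsilon> * U)"
    if Z: "cts Z" "\<And>t. \<bar>Z t\<bar> \<le> 1" "\<bar>I (\<lambda>t. \<phi> (2 * m) t * Z t)\<bar> \<le> (1 + \<bar>\<kappa>\<bar>) ^ (2 * m) * (\<epsilon> * U)" for Z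
  proof -
    define s :: real where "s = (-1) ^ (m + 1)"
    have as: "\<bar>s\<bar> = 1" by (simp add: s_def power_abs)
    define R where "R = (\<lambda>t. F t - s * \<kappa> * k (2 * m) t)"
    have Rc: "cts R" unfolding R_def by (intro continuous_intros)
    have \<phi>2: "\<phi> (2 * m) = k (2 * m)" using m_pos by (simp add: \<phi>_def)
    have Rb: "\<bar>R t\<bar> \<le> (1 + real m) * (\<epsilon> * U)" if t: "t \<in> {0..1}" for t
    proof -
      have "R t = (F t - s * (k 0 t * k (2 * m) t)) + s * (\<phi> 0 t * \<phi> (2 * m) t)"
        unfolding R_def \<phi>2 by (simp add: \<phi>_def algebra_simps)
      moreover have "\<bar>\<phi> 0 t * \<phi> (2 * m) t\<bar> \<le> \<epsilon> * U" unfolding abs_mult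
        using t m_pos \<epsilon>_nonneg by (intro mult_mono \<phi>_le_\<epsilon> \<phi>_le_U) auto
      then have "\<bar>s * (\<phi> 0 t * \<phi> (2 * m) t)\<bar> \<le> \<epsilon> * U" using as by (simp add: abs_mult)
      moreover have "\<bar>F t - s * (k 0 t * k (2 * m) t)\<bar> \<le> real m * (\<epsilon> * U)"
        using F_principal[OF t] by (simp add: s_def)
      ultimately show ?thesis by (simp add: distrib_right)
    qed
    have "I (\<lambda>t. F t * Z t) = I (\<lambda>t. s * \<kappa> * (\<phi> (2 * m) t * Z t) + R t * Z t)"
      by (rule arg_cong[where f=I]) (simp only: R_def \<phi>2, simp add: fun_eq_iff algebra_simps)
    also have "\<dots> = s * \<kappa> * I (\<lambda>t. \<phi> (2 * m) t * Z t) + I (\<lambda>t. R t * Z t)"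
      using Z(1) Rc by (subst I_add) (auto simp: I_cmult intro!: continuous_intros)
    finally have "\<bar>I (\<lambda>t. F t * Z t)\<bar> \<le> \<bar>s * \<kappa> * I (\<lambda>t. \<phi> (2 * m) t * Z t)\<bar> + \<bar>I (\<lambda>t. R t * Z t)\<bar>"
      by simp
    also have "\<bar>s * \<kappa> * I (\<lambda>t. \<phi> (2 * m) t * Z t)\<bar> \<le> \<bar>\<kappa>\<bar> * ((1 + \<bar>\<kappa>\<bar>) ^ (2 * m) * (\<epsilon> * U))"
      using as by (simp add: abs_mult mult_left_mono[OF Z(3)])
    also have "\<bar>I (\<lambda>t. R t * Z t)\<bar> \<le> (1 + real m) * (\<epsilon> * U) * 1"
    proof (rule I_abs_le_const)
      fix t :: real assume t: "t \<in> {0..1}"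
      show "\<bar>R t * Z t\<bar> \<le> (1 + real m) * (\<epsilon> * U) * 1" unfolding abs_mult
        using \<epsilon>_nonneg U_nonneg by (intro mult_mono Rb[OF t] Z(2)) auto
    qed (use Z(1) Rc in \<open>auto intro!: continuous_intros\<close>)
    finally show ?thesis by (simp add: B_def algebra_simps)
  qed
  show "\<bar>I (\<lambda>t. F t * X t)\<bar> \<le> B * (\<epsilon> * U)" "\<bar>I (\<lambda>t. F t * Y t)\<bar> \<le> B * (\<epsilon> * U)"
    using main XY_cts XY_le I_\<phi>_tangent[of "2 * m"] by auto
qed

text \<open>The integral of \<open>P\<^sup>2\<close> is a quadratic form in \<open>J(0)\<close>,
  coercive by \<open>second_moments\<close>. It equals the integral of \<open>F * P\<close> minus
  that of \<open>(F - P) * P\<close>, both at most linear in \<open>\<rho>\<close>, so one factor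
  \<open>\<rho>\<close> cancels.\<close>

lemma J0_le:
  assumes "8 * \<epsilon> \<le> \<bar>\<kappa>\<bar>"
  shows "\<bar>J1 0\<bar> + \<bar>J2 0\<bar> \<le> 8 * (B * (\<epsilon> * U) + 2 * K1)"
proof -
  define p q \<rho> where "p = J1 0" and "q = J2 0" and "\<rho> = \<bar>p\<bar> + \<bar>q\<bar>"
  define a b where "a = I (\<lambda>t. (X t)\<^sup>2)" and "b = I (\<lambda>t. (Y t)\<^sup>2)"
  define c where "c = I (\<lambda>t. X t * Y t)"
  have small: "\<bar>x\<bar> \<le> 1/8" if "\<bar>\<kappa>\<bar> * \<bar>x\<bar> \<le> \<epsilon>" for x
  proof -
    have "\<bar>\<kappa>\<bar> * \<bar>x\<bar> \<le> \<bar>\<kappa>\<bar> * (1/8)" using that assms by simp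
    then show ?thesis using \<kappa>_nz by (subst (asm) mult_le_cancel_left_pos) auto
  qed
  have "a + b = I (\<lambda>t. (X t)\<^sup>2 + (Y t)\<^sup>2)" unfolding a_def b_def
    by (subst I_add) (auto intro!: continuous_intros)
  then have ab: "a + b = 1" by (simp add: unit I_const)
  have "a - b = I (\<lambda>t. (X t)\<^sup>2 - (Y t)\<^sup>2)" unfolding a_def b_def
    by (subst I_diff) (auto intro!: continuous_intros)
  then have "\<bar>a - b\<bar> \<le> 1/8" using small second_moments(1) by simp
  then have a: "3/8 \<le> a" and b: "3/8 \<le> b" using ab by linarith+
  have c: "\<bar>c\<bar> \<le> 1/8" using small second_moments(2) by (simp add: c_def)
  have PP: "I (\<lambda>t. P t * P t) = p\<^sup>2 * a + 2 * (p * q) * c + q\<^sup>2 * b"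
  proof -
    have "I (\<lambda>t. P t * P t) = I (\<lambda>t. p\<^sup>2 * (X t)\<^sup>2 + 2 * (p * q) * (X t * Y t) + q\<^sup>2 * (Y t)\<^sup>2)"
      by (rule arg_cong[where f=I]) (simp add: P_def p_def q_def fun_eq_iff power2_eq_square algebra_simps)
    also have "\<dots> = I (\<lambda>t. p\<^sup>2 * (X t)\<^sup>2 + 2 * (p * q) * (X t * Y t)) + I (\<lambda>t. q\<^sup>2 * (Y t)\<^sup>2)"
      by (rule I_add) (auto intro!: continuous_intros)
    also have "I (\<lambda>t. p\<^sup>2 * (X t)\<^sup>2 + 2 * (p * q) * (X t * Y t))
        = I (\<lambda>t. p\<^sup>2 * (X t)\<^sup>2) + I (\<lambda>t. 2 * (p * q) * (X t * Y t))"
      by (rule I_add) (auto intro!: continuous_intros)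
    finally show ?thesis by (simp only: I_cmult a_def b_def c_def)
  qed
  \<comment> \<open>The diagonal gives \<open>3/8\<close>, the mixed term costs at most
    \<open>1/8\<close>, and \<open>\<rho>\<^sup>2 \<le> 2 * (p\<^sup>2 + q\<^sup>2)\<close> halves
    the remaining \<open>1/4\<close>.\<close>
  have "\<rho>\<^sup>2 / 8 \<le> I (\<lambda>t. P t * P t)"
  proof -
    have "\<bar>2 * (p * q) * c\<bar> \<le> (p\<^sup>2 + q\<^sup>2) * (1/8)"
    proof -
      have "2 * \<bar>p * q\<bar> \<le> p\<^sup>2 + q\<^sup>2"
        using zero_le_power2[of "\<bar>p\<bar> - \<bar>q\<bar>"] by (simp add: power2_diff abs_mult)
      then show ?thesis unfolding abs_mult[of _ c] using c by (intro mult_mono) (auto simp: abs_mult)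
    qed
    moreover have "p\<^sup>2 * (3/8) \<le> p\<^sup>2 * a" "q\<^sup>2 * (3/8) \<le> q\<^sup>2 * b"
      using a b by (intro mult_left_mono; simp)+
    moreover have "\<rho>\<^sup>2 \<le> 2 * (p\<^sup>2 + q\<^sup>2)"
      using zero_le_power2[of "\<bar>p\<bar> - \<bar>q\<bar>"] by (simp add: \<rho>_def power2_diff power2_sum)
    ultimately show ?thesis unfolding PP by (simp add: abs_le_iff field_simps)
  qed
  also have "I (\<lambda>t. P t * P t) = I (\<lambda>t. F t * P t - (F t - P t) * P t)"
    by (simp add: algebra_simps)
  also have "\<dots> = I (\<lambda>t. F t * P t) - I (\<lambda>t. (F t - P t) * P t)"
    by (rule I_diff) (auto intro!: continuous_intros)
  also have "\<dots> \<le> \<rho> * (B * (\<epsilon> * U)) + 2 * K1 * \<rho>"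
  proof -
    have "I (\<lambda>t. F t * P t) = I (\<lambda>t. p * (F t * X t) + q * (F t * Y t))"
      by (rule arg_cong[where f=I]) (simp add: P_def p_def q_def fun_eq_iff algebra_simps)
    also have "\<dots> = p * I (\<lambda>t. F t * X t) + q * I (\<lambda>t. F t * Y t)"
      by (subst I_add) (auto simp: I_cmult intro!: continuous_intros)
    finally have "\<bar>I (\<lambda>t. F t * P t)\<bar> \<le> \<bar>p\<bar> * \<bar>I (\<lambda>t. F t * X t)\<bar> + \<bar>q\<bar> * \<bar>I (\<lambda>t. F t * Y t)\<bar>"
      by (metis abs_mult abs_triangle_ineq)
    also have "\<dots> \<le> \<rho> * (B * (\<epsilon> * U))" unfolding \<rho>_def distrib_right
      by (intro add_mono mult_left_mono I_F_tangent) auto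
    finally have "\<bar>I (\<lambda>t. F t * P t)\<bar> \<le> \<rho> * (B * (\<epsilon> * U))" .
    moreover have "\<bar>I (\<lambda>t. (F t - P t) * P t)\<bar> \<le> 2 * K1 * \<rho>"
    proof (rule I_abs_le_const)
      fix t :: real assume t: "t \<in> {0..1}"
      have "\<bar>p * X t\<bar> \<le> \<bar>p\<bar> * 1" "\<bar>q * Y t\<bar> \<le> \<bar>q\<bar> * 1"
        unfolding abs_mult by (intro mult_left_mono XY_le; simp)+
      then have "\<bar>P t\<bar> \<le> \<rho>" unfolding P_def \<rho>_def p_def q_def by linarith
      then show "\<bar>(F t - P t) * P t\<bar> \<le> 2 * K1 * \<rho>" unfolding abs_mult
        using K1_nonneg by (intro mult_mono F_minus_P[OF t]) auto
    qed (auto intro!: continuous_intros)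
    ultimately show ?thesis by linarith
  qed
  finally have *: "\<rho> * \<rho> \<le> \<rho> * (8 * (B * (\<epsilon> * U) + 2 * K1))"
    by (simp add: power2_eq_square algebra_simps)
  have "\<rho> \<le> 8 * (B * (\<epsilon> * U) + 2 * K1)"
  proof (cases "\<rho> = 0")
    case True
    moreover have "B \<ge> 0" by (simp add: B_def)
    ultimately show ?thesis using \<epsilon>_nonneg U_nonneg K1_nonneg by simp
  next
    case False
    then have "\<rho> > 0" by (auto simp: \<rho>_def)
    then show ?thesis using * by (simp add: mult_le_cancel_left_pos)
  qed
  then show ?thesis by (simp add: \<rho>_def p_def q_def)
qed

text \<open>Here \<open>\<bar>k 0 t\<bar> \<ge> \<bar>\<kappa>\<bar> / 2\<close>, so the leading
  term of \<open>F\<close> controls \<open>k (2 * m)\<close>. The constants are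
  \<open>18 = 16 + 2\<close> and \<open>9 = 8 + 1\<close>, from \<open>J0_le\<close>,
  \<open>F_minus_P\<close> and \<open>F_principal\<close>.\<close>

lemma k_2m_le:
  assumes \<epsilon>: "8 * \<epsilon> \<le> \<bar>\<kappa>\<bar>" and t: "t \<in> {0..1}"
  shows "\<bar>\<kappa>\<bar> / 2 * \<bar>k (2 * m) t\<bar> \<le> 18 * K1 + 9 * B * (\<epsilon> * U)"
proof -
  have "\<bar>\<phi> 0 t\<bar> \<le> \<epsilon>" using \<phi>_le_\<epsilon> m_pos t by simp
  then have "\<bar>\<kappa>\<bar> / 2 \<le> \<bar>k 0 t\<bar>" using \<epsilon> \<epsilon>_nonneg by (simp add: \<phi>_def)
  then have "\<bar>\<kappa>\<bar> / 2 * \<bar>k (2 * m) t\<bar> \<le> \<bar>k 0 t\<bar> * \<bar>k (2 * m) t\<bar>" by (rule mult_right_mono) simp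
  also have "\<dots> = \<bar>(-1) ^ (m + 1) * (k 0 t * k (2 * m) t)\<bar>" by (simp add: abs_mult power_abs)
  also have "\<dots> \<le> \<bar>F t\<bar> + real m * (\<epsilon> * U)" using F_principal[OF t] by linarith
  also have "\<bar>F t\<bar> \<le> \<bar>J1 0\<bar> + \<bar>J2 0\<bar> + 2 * K1"
  proof -
    have "\<bar>J1 0 * X t\<bar> \<le> \<bar>J1 0\<bar> * 1" "\<bar>J2 0 * Y t\<bar> \<le> \<bar>J2 0\<bar> * 1"
      unfolding abs_mult by (intro mult_left_mono XY_le; simp)+
    then show ?thesis using F_minus_P[OF t] unfolding P_def by linarith
  qed
  also have "\<dots> \<le> 8 * (B * (\<epsilon> * U) + 2 * K1) + 2 * K1" using J0_le[OF \<epsilon>] by simp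
  also have "real m * (\<epsilon> * U) \<le> B * (\<epsilon> * U)"
    using \<epsilon>_nonneg U_nonneg by (intro mult_right_mono) (auto simp: B_def)
  finally show ?thesis by (simp add: algebra_simps)
qed

end

section \<open>Absorption, and the two regimes of small and large energy\<close>

lemma E_le_small:
  assumes "8 * \<epsilon> \<le> \<bar>\<kappa>\<bar>" "36 * B * \<epsilon> \<le> \<bar>\<kappa>\<bar>"
  shows "E \<le> (72 / \<bar>\<kappa>\<bar>)\<^sup>2 * K1\<^sup>2"
proof -
  have "cts (\<lambda>t. \<bar>k (2 * m) t\<bar>)" by (intro continuous_intros)
  then obtain x where x: "x \<in> {0..1}" "\<And>t. t \<in> {0..1} \<Longrightarrow> \<bar>k (2 * m) t\<bar> \<le> \<bar>k (2 * m) x\<bar>"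
    using continuous_attains_sup[OF compact_Icc, of 0 1 "\<lambda>t. \<bar>k (2 * m) t\<bar>"] by auto
  define U where "U = \<bar>k (2 * m) x\<bar>"
  note U = x(2)[folded U_def]
  have "\<bar>\<kappa>\<bar> / 2 * U \<le> 18 * K1 + 9 * B * (\<epsilon> * U)"
    using k_2m_le[OF U assms(1) x(1)] by (simp add: U_def)
  \<comment> \<open>Thus \<open>9 * B * \<epsilon> * U\<close> is at most
    \<open>\<bar>\<kappa>\<bar> * U / 4\<close>, half of the left side, and is absorbed. This is
    where \<open>U\<close> must be an attained maximum.\<close>
  moreover have "36 * B * \<epsilon> * U \<le> \<bar>\<kappa>\<bar> * U" using assms(2) by (intro mult_right_mono) (auto simp: U_def)
  ultimately have "\<bar>\<kappa>\<bar> * U \<le> 72 * K1" by (simp add: algebra_simps)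
  then have UK: "U \<le> 72 / \<bar>\<kappa>\<bar> * K1" using \<kappa>_nz by (simp add: field_simps)
  have "E \<le> U\<^sup>2" unfolding E_def
  proof (intro I_le_const)
    fix t :: real assume "t \<in> {0..1}"
    then have "\<bar>k m t\<bar> \<le> U" using k_le_U[OF U, of m t] m_pos by simp
    then show "(k m t)\<^sup>2 \<le> U\<^sup>2" by (simp add: abs_le_square_iff[symmetric] U_def)
  qed (intro continuous_intros)
  also have "\<dots> \<le> (72 / \<bar>\<kappa>\<bar> * K1)\<^sup>2" using UK by (intro power_mono) (auto simp: U_def)
  finally show ?thesis by (simp only: power_mult_distrib)
qed

text \<open>The sum of the two factors 8 and \<open>36 * B\<close> serves as threshold for
  \<open>\<epsilon>\<close>. Below it \<open>E_le_small\<close> applies; above it the linear bound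
  \<open>E_le_K1\<close> becomes quadratic. Cauchy-Schwarz then replaces
  \<open>K1\<^sup>2\<close>.\<close>

lemma E_le_I_K_square: "E \<le> ((72 / \<bar>\<kappa>\<bar>)\<^sup>2 + 4 * ((8 + 36 * B) / \<bar>\<kappa>\<bar>)\<^sup>2) * I (\<lambda>t. (K t)\<^sup>2)"
proof -
  have B: "B \<ge> 0" by (simp add: B_def)
  have "E \<le> ((72 / \<bar>\<kappa>\<bar>)\<^sup>2 + 4 * ((8 + 36 * B) / \<bar>\<kappa>\<bar>)\<^sup>2) * K1\<^sup>2"
  proof (cases "(8 + 36 * B) * \<epsilon> \<le> \<bar>\<kappa>\<bar>")
    case True
    have "8 * \<epsilon> + 36 * B * \<epsilon> \<le> \<bar>\<kappa>\<bar>" using True by (simp add: distrib_right)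
    moreover have "0 \<le> 36 * B * \<epsilon>" using B \<epsilon>_nonneg by simp
    ultimately have "8 * \<epsilon> \<le> \<bar>\<kappa>\<bar>" "36 * B * \<epsilon> \<le> \<bar>\<kappa>\<bar>" using \<epsilon>_nonneg by linarith+
    then have "E \<le> (72 / \<bar>\<kappa>\<bar>)\<^sup>2 * K1\<^sup>2" by (rule E_le_small)
    then show ?thesis by (simp add: distrib_right add_increasing2)
  next
    case False
    \<comment> \<open>Failure of the threshold says \<open>1 \<le> M * \<epsilon>\<close>; squaring
      and multiplying by \<open>E = \<epsilon>\<^sup>2\<close> gives
      \<open>E \<le> M\<^sup>2 * E\<^sup>2\<close>.\<close>
    define M where "M = (8 + 36 * B) / \<bar>\<kappa>\<bar>"
    have "1 \<le> M * \<epsilon>" using False \<kappa>_nz by (simp add: M_def field_simps)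
    then have "1 \<le> (M * \<epsilon>)\<^sup>2" by (simp add: one_le_power)
    then have "1 * E \<le> M\<^sup>2 * E * E"
      using E_nonneg by (intro mult_right_mono) (auto simp: \<epsilon>_def power_mult_distrib)
    also have "\<dots> = M\<^sup>2 * E\<^sup>2" by (simp add: power2_eq_square)
    also have "\<dots> \<le> M\<^sup>2 * (2 * K1)\<^sup>2"
      using E_le_K1 E_nonneg by (intro mult_left_mono power_mono) auto
    finally have "E \<le> 4 * M\<^sup>2 * K1\<^sup>2" by (simp add: power_mult_distrib)
    then show ?thesis unfolding M_def by (simp add: distrib_right add_increasing)
  qed
  also have "\<dots> \<le> ((72 / \<bar>\<kappa>\<bar>)\<^sup>2 + 4 * ((8 + 36 * B) / \<bar>\<kappa>\<bar>)\<^sup>2) * I (\<lambda>t. (K t)\<^sup>2)"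
    unfolding K1_def by (intro mult_left_mono I_abs_square_le K_cts) auto
  finally show ?thesis .
qed

end

section \<open>Smooth immersed curves\<close>

text \<open>A finite-order version of \<open>smooth_fun\<close>, recursive in the order so that
  closure under arithmetic follows by induction without formulas for higher derivatives.\<close>

fun n_diff :: "nat \<Rightarrow> (real \<Rightarrow> real) \<Rightarrow> bool" where
  "n_diff 0 f = True"
| "n_diff (Suc n) f = ((\<forall>t. f differentiable (at t)) \<and> n_diff n (deriv f))"

lemma n_diff_SucD: "n_diff (Suc n) f \<Longrightarrow> n_diff n f"
  by (induction n arbitrary: f) auto

lemma n_diff_of_smooth: "smooth_fun f \<Longrightarrow> n_diff n f"
proof (induction n arbitrary: f)
  case (Suc n)
  have "smooth_fun (deriv f)"
    using Suc.prems unfolding smooth_fun_def by (metis comp_apply funpow_Suc_right)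
  moreover have "f differentiable (at t)" for t
    using Suc.prems[unfolded smooth_fun_def, rule_format, of 0] by simp
  ultimately show ?case using Suc.IH by simp
qed simp

lemma n_diff_DERIV: "n_diff (Suc n) f \<Longrightarrow> (f has_real_derivative deriv f t) (at t)"
  using DERIV_deriv_iff_real_differentiable by auto

lemma n_diff_SucI:
  assumes "\<And>t. (f has_real_derivative f' t) (at t)" "n_diff n f'"
  shows "n_diff (Suc n) f"
proof -
  have "deriv f = f'" using assms(1) DERIV_imp_deriv by blast
  then show ?thesis using assms real_differentiable_def by auto
qed

lemma n_diff_add: "n_diff n f \<Longrightarrow> n_diff n g \<Longrightarrow> n_diff n (\<lambda>t. f t + g t)"
proof (induction n arbitrary: f g)
  case (Suc n)
  show ?case
    by (rule n_diff_SucI[where f'="\<lambda>t. deriv f t + deriv g t"])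
       (use Suc n_diff_DERIV in \<open>auto intro!: derivative_eq_intros\<close>)
qed simp

lemma n_diff_mult: "n_diff n f \<Longrightarrow> n_diff n g \<Longrightarrow> n_diff n (\<lambda>t. f t * g t)"
proof (induction n arbitrary: f g)
  case (Suc n)
  show ?case
  proof (rule n_diff_SucI)
    show "((\<lambda>t. f t * g t) has_real_derivative deriv f t * g t + deriv g t * f t) (at t)" for t
      using Suc.prems n_diff_DERIV by (intro DERIV_mult) auto
    show "n_diff n (\<lambda>t. deriv f t * g t + deriv g t * f t)"
      using Suc n_diff_SucD by (intro n_diff_add) auto
  qed
qed simp

lemma n_diff_const: "n_diff n (\<lambda>t. c)"
  by (induction n arbitrary: c) auto

lemma n_diff_cmult: "n_diff n f \<Longrightarrow> n_diff n (\<lambda>t. c * f t)"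
  by (intro n_diff_mult n_diff_const)

lemma n_diff_diff: "n_diff n f \<Longrightarrow> n_diff n g \<Longrightarrow> n_diff n (\<lambda>t. f t - g t)"
  using n_diff_add[of n f "\<lambda>t. (-1) * g t"] n_diff_cmult[of n g "-1"] by simp

text \<open>The derivative is a product involving the inverse itself, which the induction hypothesis
  covers at the lower order. The square root below works the same way.\<close>

lemma n_diff_inverse: "n_diff n f \<Longrightarrow> (\<And>t. f t \<noteq> 0) \<Longrightarrow> n_diff n (\<lambda>t. inverse (f t))"
proof (induction n arbitrary: f)
  case (Suc n)
  show ?case
  proof (rule n_diff_SucI)
    show "((\<lambda>t. inverse (f t)) has_real_derivative (-1) * (deriv f t * (inverse (f t) * inverse (f t)))) (at t)" for t
      using Suc.prems n_diff_DERIV by (auto intro!: derivative_eq_intros)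
    show "n_diff n (\<lambda>t. (-1) * (deriv f t * (inverse (f t) * inverse (f t))))"
      using Suc n_diff_SucD by (intro n_diff_cmult n_diff_mult) auto
  qed
qed simp

lemma n_diff_divide: "n_diff n f \<Longrightarrow> n_diff n g \<Longrightarrow> (\<And>t. g t \<noteq> 0) \<Longrightarrow> n_diff n (\<lambda>t. f t / g t)"
  unfolding divide_inverse by (intro n_diff_mult n_diff_inverse)

lemma n_diff_power: "n_diff n f \<Longrightarrow> n_diff n (\<lambda>t. f t ^ p)"
  by (induction p) (auto intro: n_diff_mult n_diff_const)

lemma n_diff_sqrt: "n_diff n f \<Longrightarrow> (\<And>t. f t > 0) \<Longrightarrow> n_diff n (\<lambda>t. sqrt (f t))"
proof (induction n)
  case (Suc n)
  have pos: "sqrt (f t) \<noteq> 0" for t using Suc.prems(2)[of t] by simp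
  show ?case
  proof (rule n_diff_SucI)
    show "((\<lambda>t. sqrt (f t)) has_real_derivative (1/2) * (deriv f t / sqrt (f t))) (at t)" for t
      using n_diff_DERIV[OF Suc.prems(1), of t] Suc.prems(2)[of t]
      by (auto intro!: derivative_eq_intros simp: field_simps)
    show "n_diff n (\<lambda>t. (1/2) * (deriv f t / sqrt (f t)))"
      using Suc n_diff_SucD pos by (intro n_diff_cmult n_diff_divide) auto
  qed
qed simp

text \<open>The derivative relations at \<open>t + 1\<close> and \<open>t\<close> agree for every
  \<open>D\<close>, so the choice in \<open>deriv\<close> returns the same value at both
  points.\<close>

lemma deriv_periodic:
  fixes f :: "real \<Rightarrow> real"
  assumes "\<And>t. f (t + 1) = f t" shows "deriv f (t + 1) = deriv f t"
proof -
  have "(f has_real_derivative D) (at (t + 1)) \<longleftrightarrow> (f has_real_derivative D) (at t)" for D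
    using DERIV_shift[of f D t 1] assms by simp
  then show ?thesis unfolding deriv_def by simp
qed

section \<open>Frenet data of a closed immersion\<close>

locale closed_immersion =
  fixes \<gamma> :: "real \<Rightarrow> real \<times> real"
  assumes smooth: "smooth_closed_immersed \<gamma>"
begin

abbreviation x' where "x' \<equiv> deriv (cx \<gamma>)"
abbreviation y' where "y' \<equiv> deriv (cy \<gamma>)"

lemma n_diff_coords: "n_diff n (cx \<gamma>)" "n_diff n (cy \<gamma>)"
  using smooth n_diff_of_smooth unfolding smooth_closed_immersed_def by auto

lemma n_diff_derivs: "n_diff n x'" "n_diff n y'"
  "n_diff n (deriv x')" "n_diff n (deriv y')"
  using n_diff_coords[of "Suc (Suc n)"] n_diff_coords[of "Suc n"] by auto

lemma speed_square_pos: "(x' t)\<^sup>2 + (y' t)\<^sup>2 > 0"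
  using smooth unfolding smooth_closed_immersed_def by (auto simp: sum_power2_gt_zero_iff)

lemma speed_pos: "speed \<gamma> t > 0"
  using speed_square_pos by (simp add: speed_def)

lemma speed_square: "(speed \<gamma> t)\<^sup>2 = (x' t)\<^sup>2 + (y' t)\<^sup>2"
  using speed_square_pos[of t] by (simp add: speed_def)

lemma n_diff_speed: "n_diff n (speed \<gamma>)"
  unfolding speed_def[abs_def]
  by (intro n_diff_sqrt n_diff_add n_diff_power n_diff_derivs speed_square_pos)

text \<open>Each arclength derivative consumes one order, hence the induction is over all
  \<open>n\<close> at once.\<close>

lemma n_diff_curv_s: "n_diff n (curv_s \<gamma> j)"
proof (induction j arbitrary: n)
  case 0
  have "speed \<gamma> t ^ 3 \<noteq> 0" for t using speed_pos[of t] by simp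
  then show ?case unfolding curv_s_def curv_def
    by (simp, intro n_diff_divide n_diff_diff n_diff_mult n_diff_derivs n_diff_power n_diff_speed)
next
  case (Suc j)
  have "n_diff n (deriv (curv_s \<gamma> j))" using Suc[of "Suc n"] by simp
  moreover have "speed \<gamma> t \<noteq> 0" for t using speed_pos[of t] by simp
  ultimately show ?case unfolding curv_s_def sderiv_def
    by (simp, intro n_diff_divide n_diff_speed)
qed

lemma curv_s_deriv: "(curv_s \<gamma> j has_real_derivative curv_s \<gamma> (Suc j) t * speed \<gamma> t) (at t)"
proof -
  have "curv_s \<gamma> (Suc j) t * speed \<gamma> t = deriv (curv_s \<gamma> j) t"
    using speed_pos[of t] by (simp add: curv_s_def sderiv_def)
  then show ?thesis using n_diff_DERIV[OF n_diff_curv_s[of "Suc 0" j]] by simp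
qed

lemma coords_periodic: "cx \<gamma> (t + 1) = cx \<gamma> t" "cy \<gamma> (t + 1) = cy \<gamma> t"
  using smooth unfolding smooth_closed_immersed_def cx_def cy_def by auto

lemma derivs_periodic: "x' (t + 1) = x' t" "y' (t + 1) = y' t"
  by (intro deriv_periodic coords_periodic)+

lemma speed_periodic: "speed \<gamma> (t + 1) = speed \<gamma> t"
  by (simp add: speed_def derivs_periodic)

lemma curv_s_periodic: "curv_s \<gamma> j (t + 1) = curv_s \<gamma> j t"
proof (induction j arbitrary: t)
  case 0
  then show ?case
    by (simp add: curv_s_def curv_def derivs_periodic speed_periodic deriv_periodic[of x'] deriv_periodic[of y'])
next
  case (Suc j)
  have "deriv (curv_s \<gamma> j) (t + 1) = deriv (curv_s \<gamma> j) t" by (intro deriv_periodic Suc)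
  then show ?case by (simp add: curv_s_def sderiv_def speed_periodic)
qed

text \<open>The Frenet equations, with \<open>ds = speed dt\<close> kept explicit.\<close>

lemma tangent_deriv:
  "((\<lambda>t. x' t / speed \<gamma> t) has_real_derivative - curv \<gamma> t * (y' t / speed \<gamma> t) * speed \<gamma> t) (at t)"
  "((\<lambda>t. y' t / speed \<gamma> t) has_real_derivative curv \<gamma> t * (x' t / speed \<gamma> t) * speed \<gamma> t) (at t)"
proof -
  define s where "s = speed \<gamma> t"
  have s: "s > 0" "s\<^sup>2 = (x' t)\<^sup>2 + (y' t)\<^sup>2" using speed_pos speed_square by (auto simp: s_def)
  have d: "(x' has_real_derivative deriv x' t) (at t)" "(y' has_real_derivative deriv y' t) (at t)"
    using n_diff_DERIV n_diff_derivs by blast+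
  have ds: "(speed \<gamma> has_real_derivative (x' t * deriv x' t + y' t * deriv y' t) / s) (at t)"
  proof -
    have "((\<lambda>t. (x' t)\<^sup>2 + (y' t)\<^sup>2) has_real_derivative 2 * x' t * deriv x' t + 2 * y' t * deriv y' t) (at t)"
      using d by (auto intro!: derivative_eq_intros)
    from DERIV_chain2[OF DERIV_real_sqrt[OF speed_square_pos] this]
    have "((\<lambda>t. sqrt ((x' t)\<^sup>2 + (y' t)\<^sup>2)) has_real_derivative
        inverse s / 2 * (2 * x' t * deriv x' t + 2 * y' t * deriv y' t)) (at t)"
      by (simp only: s_def speed_def)
    then show ?thesis unfolding speed_def[abs_def]
      by (rule DERIV_cong) (use s(1) in \<open>simp add: field_simps\<close>)
  qed
  have quot: "((\<lambda>t. f t / speed \<gamma> t) has_real_derivative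
      (f' * s\<^sup>2 - f t * (x' t * deriv x' t + y' t * deriv y' t)) / s ^ 3) (at t)"
    if "(f has_real_derivative f') (at t)" for f f'
    using DERIV_divide[OF that ds] s(1)
    by (simp add: s_def[symmetric] field_simps power2_eq_square power3_eq_cube)
  have c: "curv \<gamma> t = (x' t * deriv y' t - y' t * deriv x' t) / s ^ 3" by (simp add: curv_def s_def)
  \<comment> \<open>After substituting for \<open>s\<^sup>2\<close>, the numerators become
    \<open>- y'\<close> and \<open>x'\<close> times the numerator of the curvature.\<close>
  have "(deriv x' t * s\<^sup>2 - x' t * (x' t * deriv x' t + y' t * deriv y' t)) / s ^ 3 = - curv \<gamma> t * (y' t / s) * s"
    "(deriv y' t * s\<^sup>2 - y' t * (x' t * deriv x' t + y' t * deriv y' t)) / s ^ 3 = curv \<gamma> t * (x' t / s) * s"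
    unfolding c s(2) using s(1) by (simp_all add: field_simps power2_eq_square)
  then show "((\<lambda>t. x' t / speed \<gamma> t) has_real_derivative - curv \<gamma> t * (y' t / speed \<gamma> t) * speed \<gamma> t) (at t)"
    "((\<lambda>t. y' t / speed \<gamma> t) has_real_derivative curv \<gamma> t * (x' t / speed \<gamma> t) * speed \<gamma> t) (at t)"
    using quot[OF d(1)] quot[OF d(2)] by (simp_all add: s_def)
qed

lemma speed_cont: "continuous_on {0..1} (speed \<gamma>)"
  using n_diff_DERIV[OF n_diff_speed[of "Suc 0"]] by (meson DERIV_isCont continuous_at_imp_continuous_on)

lemma length_pos: "curve_length \<gamma> > 0"
proof -
  have eq: "curve_length \<gamma> = integral {0..1} (speed \<gamma>)" by (simp add: curve_length_def curve_integral_ds_def)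
  have "integral {0..1} (speed \<gamma>) \<noteq> 0"
    using integral_eq_0_iff[OF speed_cont] speed_pos by (auto simp: less_imp_le) (metis less_irrefl atLeastAtMost_iff order_refl zero_le_one)
  moreover have "integral {0..1} (speed \<gamma>) \<ge> 0"
    using speed_pos by (intro integral_nonneg integrable_continuous_interval speed_cont) (auto simp: less_imp_le)
  ultimately show ?thesis using eq by simp
qed

text \<open>Closedness of the curve; after weighting it is the vanishing mean of the unit
  tangent.\<close>

lemma integral_derivs: "integral {0..1} x' = 0" "integral {0..1} y' = 0"
proof -
  have "(deriv f has_integral f 1 - f 0) {0..1}" if "n_diff (Suc 0) f" for f
    using n_diff_DERIV[OF that]
    by (intro fundamental_theorem_of_calculus)
       (auto simp: has_real_derivative_iff_has_vector_derivative[symmetric] intro: has_field_derivative_at_within)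
  from this[of "cx \<gamma>"] this[of "cy \<gamma>"] show "integral {0..1} x' = 0" "integral {0..1} y' = 0"
    using n_diff_coords[of "Suc 0"] coords_periodic[of 0] by (auto dest: integral_unique)
qed

text \<open>\<open>M\<close> is the constant of \<open>E_le_I_K_square\<close>, with
  \<open>\<beta>\<close> for \<open>B\<close>. Scaling by the length multiplies the energy by
  \<open>L ^ (2 * m + 1)\<close> and the squared gradient by \<open>L ^ (4 * m + 5)\<close>; the
  quotient is the stated power.\<close>

lemma energy_gap:
  fixes w :: real and m :: nat
  defines "\<kappa> \<equiv> 2 * pi * w"
  defines "\<beta> \<equiv> \<bar>\<kappa>\<bar> * (1 + \<bar>\<kappa>\<bar>) ^ (2 * m) + 1 + real m"
  defines "M \<equiv> (72 / \<bar>\<kappa>\<bar>)\<^sup>2 + 4 * ((8 + 36 * \<beta>) / \<bar>\<kappa>\<bar>)\<^sup>2"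
  assumes m: "m \<ge> 1" and w: "w \<noteq> 0" and turn: "turning_number \<gamma> = w"
  shows "2 * energy m \<gamma> \<le> M * curve_length \<gamma> ^ (2 * m + 4) * curve_integral_ds \<gamma> (\<lambda>t. (Kop m \<gamma> t)\<^sup>2)"
proof -
  define L where "L = curve_length \<gamma>"
  have L: "L > 0" using length_pos by (simp add: L_def)
  have Lint: "L = integral {0..1} (speed \<gamma>)" by (simp add: L_def curve_length_def curve_integral_ds_def)
  define v where "v = (\<lambda>t. speed \<gamma> t / L)"
  \<comment> \<open>Curvature has the dimension of an inverse length and every arclength derivative
    adds one more. Only these data are rescaled, not the curve.\<close>
  define k where "k = (\<lambda>j t. L ^ (j + 1) * curv_s \<gamma> j t)"
  define X where "X = (\<lambda>t. x' t / speed \<gamma> t)"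
  define Y where "Y = (\<lambda>t. y' t / speed \<gamma> t)"
  interpret unit_weight v
  proof
    show "continuous_on {0..1} v" unfolding v_def using L by (intro continuous_intros speed_cont) auto
    show "v t > 0" for t using L speed_pos by (simp add: v_def)
    show "integral {0..1} v = 1" unfolding v_def using L Lint by (simp add: divide_inverse)
  qed
  have I: "I f = curve_integral_ds \<gamma> f / L" for f
    unfolding I_def curve_integral_ds_def by (simp add: v_def)
  have sp: "speed \<gamma> t \<noteq> 0" for t using speed_pos[of t] by simp
  have k0: "k 0 = (\<lambda>t. L * curv \<gamma> t)" by (simp add: k_def curv_s_def)
  interpret closed_curve_frame v k X Y \<kappa> m
  proof
    show "arc_deriv (k j) (k (Suc j))" for j
    proof -
      have "((\<lambda>t. L ^ (j + 1) * curv_s \<gamma> j t) has_real_derivative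
          L ^ (j + 1) * (curv_s \<gamma> (Suc j) t * speed \<gamma> t)) (at t)" for t
        by (rule DERIV_cmult[OF curv_s_deriv])
      then show ?thesis using L unfolding arc_deriv_def by (simp add: k_def v_def mult_ac)
    qed
    show "k j 1 = k j 0" for j using curv_s_periodic[of j 0] by (simp add: k_def)
    show "arc_deriv X (\<lambda>t. - k 0 t * Y t)" "arc_deriv Y (\<lambda>t. k 0 t * X t)"
      using tangent_deriv L unfolding arc_deriv_def by (simp_all add: k0 X_def Y_def v_def sp)
    show "X 1 = X 0" "Y 1 = Y 0"
      using derivs_periodic[of 0] speed_periodic[of 0] by (simp_all add: X_def Y_def)
    show "(X t)\<^sup>2 + (Y t)\<^sup>2 = 1" for t
      by (simp add: X_def Y_def power_divide sp flip: add_divide_distrib speed_square)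
    show "I X = 0" "I Y = 0"
      unfolding I curve_integral_ds_def X_def Y_def using sp integral_derivs by simp_all
    have "curve_integral_ds \<gamma> (\<lambda>t. L * curv \<gamma> t) = L * curve_integral_ds \<gamma> (curv \<gamma>)"
      unfolding curve_integral_ds_def by (simp add: mult.assoc)
    then show "I (k 0) = \<kappa>" using turn L by (simp add: I k0 turning_number_def \<kappa>_def field_simps)
    show "\<kappa> \<noteq> 0" using w by (simp add: \<kappa>_def)
    show "m \<ge> 1" by (rule m)
  qed
  have scale: "curve_integral_ds \<gamma> (\<lambda>t. (c * f t)\<^sup>2) = c\<^sup>2 * curve_integral_ds \<gamma> (\<lambda>t. (f t)\<^sup>2)" for c f
    unfolding curve_integral_ds_def by (simp add: power_mult_distrib mult.assoc)
  have K: "K = (\<lambda>t. L ^ (2 * m + 3) * Kop m \<gamma> t)"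
  proof
    fix t
    have "(\<Sum>r = 1..m. (-1) ^ (r + 1) * k (m - r) t * k (m + r) t)
        = L ^ (2 * m + 2) * (\<Sum>r = 1..m. (-1) ^ (r + 1) * curv_s \<gamma> (m - r) t * curv_s \<gamma> (m + r) t)"
      unfolding sum_distrib_left
    proof (rule sum.cong)
      fix r assume "r \<in> {1..m}"
      \<comment> \<open>All summands are homogeneous of the same degree; the identity uses
        \<open>r \<le> m\<close>.\<close>
      then have "2 * m + 2 = (m - r + 1) + (m + r + 1)" by simp
      then have "L ^ (2 * m + 2) = L ^ (m - r + 1) * L ^ (m + r + 1)" by (metis power_add)
      then show "(-1) ^ (r + 1) * k (m - r) t * k (m + r) t
          = L ^ (2 * m + 2) * ((-1) ^ (r + 1) * curv_s \<gamma> (m - r) t * curv_s \<gamma> (m + r) t)"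
        unfolding k_def by (simp only: mult_ac)
    qed simp
    moreover have "(k m t)\<^sup>2 = L ^ (2 * m + 2) * (curv_s \<gamma> m t)\<^sup>2"
      by (simp add: k_def power2_eq_square mult_2 power_add)
    moreover have "2 * m + 3 = Suc (2 * m + 2)" "2 * m + 2 + 1 = 2 * m + 3" by simp_all
    then have "L ^ (2 * m + 3) = L * L ^ (2 * m + 2)"
      and "k (2 * m + 2) t = L ^ (2 * m + 3) * curv_s \<gamma> (2 * m + 2) t"
      by (simp_all only: k_def power_Suc)
    ultimately show "K t = L ^ (2 * m + 3) * Kop m \<gamma> t"
      unfolding K_def Kop_def k0 by (simp only: right_diff_distrib distrib_left mult_ac times_divide_eq_right)
  qed
  \<comment> \<open>The average \<open>I\<close> carries a factor \<open>1 / L\<close>, removed by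
    splitting one \<open>L\<close> off each squared power.\<close>
  have cancel: "a * L * b / L = a * b" for a b using L by simp
  have "E = I (\<lambda>t. (L ^ (m + 1) * curv_s \<gamma> m t)\<^sup>2)"
    unfolding E_def by (simp add: k_def)
  also have "\<dots> = (L ^ (m + 1))\<^sup>2 * (2 * energy m \<gamma>) / L"
    unfolding I scale energy_def by simp
  also have "(L ^ (m + 1))\<^sup>2 = L ^ (2 * m + 1) * L"
  proof -
    have "(m + 1) * 2 = (2 * m + 1) + 1" by simp
    then show ?thesis by (metis power_add power_mult power_one_right)
  qed
  finally have E: "E = L ^ (2 * m + 1) * (2 * energy m \<gamma>)"
    using cancel by metis
  have "I (\<lambda>t. (K t)\<^sup>2) = (L ^ (2 * m + 3))\<^sup>2 * curve_integral_ds \<gamma> (\<lambda>t. (Kop m \<gamma> t)\<^sup>2) / L"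
    unfolding I K scale by simp
  also have "(L ^ (2 * m + 3))\<^sup>2 = L ^ (2 * m + 1) * L ^ (2 * m + 4) * L"
  proof -
    have "(2 * m + 3) * 2 = (2 * m + 1) + (2 * m + 4) + 1" by simp
    then show ?thesis by (metis power_add power_mult power_one_right)
  qed
  finally have IK: "I (\<lambda>t. (K t)\<^sup>2) = L ^ (2 * m + 1) * (L ^ (2 * m + 4) * curve_integral_ds \<gamma> (\<lambda>t. (Kop m \<gamma> t)\<^sup>2))"
    using cancel mult.assoc by metis
  have "E \<le> M * I (\<lambda>t. (K t)\<^sup>2)"
    using E_le_I_K_square unfolding M_def \<beta>_def B_def .
  then have "L ^ (2 * m + 1) * (2 * energy m \<gamma>)
      \<le> L ^ (2 * m + 1) * (M * L ^ (2 * m + 4) * curve_integral_ds \<gamma> (\<lambda>t. (Kop m \<gamma> t)\<^sup>2))"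
    unfolding E IK by (simp add: mult_ac)
  then show ?thesis using L unfolding L_def by (subst (asm) mult_le_cancel_left_pos) auto
qed

end

theorem theorem1p2:
  fixes m :: nat and w :: int
  assumes "m \<ge> 1" and "w \<noteq> 0"
  shows "\<exists>C > 0. \<forall>\<gamma>. smooth_closed_immersed \<gamma> \<and> turning_number \<gamma> = of_int w \<longrightarrow>
           curve_integral_ds \<gamma> (\<lambda>t. (Kop m \<gamma> t)\<^sup>2)
             \<ge> C * (1 / curve_length \<gamma> ^ (2 * m + 4)) * energy m \<gamma>"
proof -
  define \<kappa> where "\<kappa> = 2 * pi * real_of_int w"
  define M where "M = (72 / \<bar>\<kappa>\<bar>)\<^sup>2
    + 4 * ((8 + 36 * (\<bar>\<kappa>\<bar> * (1 + \<bar>\<kappa>\<bar>) ^ (2 * m) + 1 + real m)) / \<bar>\<kappa>\<bar>)\<^sup>2"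
  have "\<kappa> \<noteq> 0" using assms(2) by (simp add: \<kappa>_def)
  \<comment> \<open>The first square in \<open>M\<close> is positive because the turning number is
    nonzero.\<close>
  then have M: "M > 0" unfolding M_def by (intro add_pos_nonneg) auto
  \<comment> \<open>The 2 comes from the factor one half in \<open>energy\<close>; \<open>M\<close>
    depends on \<open>m\<close> and \<open>w\<close> only.\<close>
  have "2 / M * (1 / curve_length \<gamma> ^ (2 * m + 4)) * energy m \<gamma> \<le> curve_integral_ds \<gamma> (\<lambda>t. (Kop m \<gamma> t)\<^sup>2)"
    if \<gamma>: "smooth_closed_immersed \<gamma>" "turning_number \<gamma> = of_int w" for \<gamma>
  proof -
    interpret closed_immersion \<gamma> by unfold_locales (rule \<gamma>(1))
    have "2 * energy m \<gamma> \<le> M * curve_length \<gamma> ^ (2 * m + 4) * curve_integral_ds \<gamma> (\<lambda>t. (Kop m \<gamma> t)\<^sup>2)"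
      using energy_gap[OF assms(1) _ \<gamma>(2)] assms(2) unfolding M_def \<kappa>_def by simp
    moreover have "M * curve_length \<gamma> ^ (2 * m + 4) > 0" using M length_pos by simp
    ultimately show ?thesis by (simp add: field_simps)
  qed
  then show ?thesis using M by (intro exI[of _ "2 / M"]) auto
qed

end
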